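(* Let $k\ge0$ be an integer and $G$ a graph. If $\max\rho(G)>k$ and $\max\rho(G-v)\le k$ for every vertex $v$ of $G$, then $|V(G)|=2k+2$.
   Context: Graphs are finite and simple. $\rho_G(X)$ is the binary rank of the $X\times(V(G)\setminus X)$ matrix with $(i,j)$-entry $1$ iff $i,j$ adjacent; $\max\rho(G)=\max_{S\subseteq V(G)}\rho_G(S)$. *)

theory Defs
  imports
    Graph_Theory.Digraph
    "HOL-Library.Z2"
    "HOL-Library.Function_Algebras"
begin

definition fun_scale :: "'f::field \<Rightarrow> ('j \<Rightarrow> 'f) \<Rightarrow> 'j \<Rightarrow> 'f" where
  "fun_scale c f = (\<lambda>j. c * f j)"

global_interpretation fun_vs: vector_space "fun_scale :: 'f::field \<Rightarrow> ('j \<Rightarrow> 'f) \<Rightarrow> 'j \<Rightarrow> 'f"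
  by unfold_locales (auto simp: fun_scale_def fun_eq_iff algebra_simps)

text \<open>
  An \<open>I \<times> J\<close> matrix over a field is a function \<open>A\<close> of two arguments, of which only the values
  on \<open>I \<times> J\<close> matter. A row is a vector indexed by \<open>J\<close>, encoded as a function that is zero
  outside \<open>J\<close>. As for \<open>rank\<close> in HOL-Analysis, the rank is the dimension of the row space, but
  here with finite index sets instead of finite index types.
\<close>

definition matrix_row :: "'j set \<Rightarrow> ('i \<Rightarrow> 'j \<Rightarrow> 'f::field) \<Rightarrow> 'i \<Rightarrow> 'j \<Rightarrow> 'f" where
  "matrix_row J A i = (\<lambda>j. if j \<in> J then A i j else 0)"

definition matrix_rank :: "'i set \<Rightarrow> 'j set \<Rightarrow> ('i \<Rightarrow> 'j \<Rightarrow> 'f::field) \<Rightarrow> nat" where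
  "matrix_rank I J A = fun_vs.dim (matrix_row J A ` I)"

text \<open>
  Finite simple graphs are the finite, loopless, symmetric digraphs without parallel arcs, i.e.
  the locale \<open>graph\<close>. The type \<open>bit\<close> is the field with two elements.
\<close>

definition adj_entry :: "('a, 'b) pre_digraph \<Rightarrow> 'a \<Rightarrow> 'a \<Rightarrow> bit" where
  "adj_entry G i j = (if i \<rightarrow>\<^bsub>G\<^esub> j then 1 else 0)"

definition cut_rank :: "('a, 'b) pre_digraph \<Rightarrow> 'a set \<Rightarrow> nat" where
  "cut_rank G X = matrix_rank X (verts G - X) (adj_entry G)"

definition max_cut_rank :: "('a, 'b) pre_digraph \<Rightarrow> nat" where
  "max_cut_rank G = Max {cut_rank G S | S. S \<subseteq> verts G}"

end

theory Submission
  imports Defs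
begin

text \<open>
  Take a set \<open>S\<close> of cut rank more than \<open>k\<close>, pick \<open>k + 1\<close> independent rows of its cut matrix,
  indexed by \<open>I\<close>, and then at most \<open>k + 1\<close> columns, indexed by \<open>J\<close>, that span all columns of
  this submatrix. The \<open>I \<times> J\<close> submatrix has rank \<open>k + 1\<close>, so a vertex \<open>v\<close> outside \<open>I \<union> J\<close> could
  be deleted with \<open>G - v\<close> still having a set of cut rank more than \<open>k\<close>, namely \<open>I\<close>. Hence
  \<open>I \<union> J\<close> contains all vertices. Conversely, \<open>S\<close> and its complement have at least \<open>k + 1\<close>
  vertices each.
\<close>

text \<open>Coordinate projection with the type of the rows kept, so that discarding columns becomes
  the image under a linear map.\<close>

definition restrict_zero :: "'j set \<Rightarrow> ('j \<Rightarrow> 'f::field) \<Rightarrow> 'j \<Rightarrow> 'f" where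
  "restrict_zero J f = (\<lambda>j. if j \<in> J then f j else 0)"

lemma linear_restrict_zero: "Vector_Spaces.linear fun_scale fun_scale (restrict_zero J)"
  by unfold_locales (auto simp: restrict_zero_def fun_scale_def fun_eq_iff algebra_simps)

lemma restrict_zero_matrix_row:
  assumes "J' \<subseteq> J"
  shows "restrict_zero J' ` matrix_row J A ` I = matrix_row J' A ` I"
  using assms by (force simp: image_image restrict_zero_def matrix_row_def fun_eq_iff intro!: image_cong)

lemma matrix_rank_le_card_rows:
  assumes "finite I"
  shows "matrix_rank I J A \<le> card I"
  unfolding matrix_rank_def
  using assms by (intro order_trans[OF fun_vs.dim_le_card' card_image_le] finite_imageI)

lemma in_span_unit_vectors:
  fixes f :: "'j \<Rightarrow> 'f::field"
  assumes "finite J" and "\<And>j. j \<notin> J \<Longrightarrow> f j = 0"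
  shows "f \<in> fun_vs.span ((\<lambda>j i. if i = j then 1 else 0) ` J)"
  using assms
proof (induction J arbitrary: f rule: finite_induct)
  case empty
  then have "f = 0"
    by (simp add: fun_eq_iff)
  then show ?case
    by (simp only: fun_vs.span_zero)
next
  case (insert x J)
  let ?e = "(\<lambda>j i. if i = j then 1 else 0) :: 'j \<Rightarrow> 'j \<Rightarrow> 'f"
  have "f(x := 0) \<in> fun_vs.span (?e ` J)"
    using insert by (intro insert.IH) auto
  then have "f(x := 0) \<in> fun_vs.span (?e ` insert x J)"
    by (rule subsetD[OF fun_vs.span_mono[OF image_mono[OF subset_insertI]]])
  moreover have "fun_scale (f x) (?e x) \<in> fun_vs.span (?e ` insert x J)"
    by (simp add: fun_vs.span_base fun_vs.span_scale)
  ultimately have "f(x := 0) + fun_scale (f x) (?e x) \<in> fun_vs.span (?e ` insert x J)"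
    by (rule fun_vs.span_add)
  also have "f(x := 0) + fun_scale (f x) (?e x) = f"
    by (auto simp: fun_scale_def fun_eq_iff)
  finally show ?case .
qed

text \<open>All rows vanish outside \<open>J\<close>, so the unit vectors indexed by
  \<open>J\<close> span them.\<close>

lemma matrix_rank_le_card_columns:
  fixes A :: "'i \<Rightarrow> 'j \<Rightarrow> 'f::field"
  assumes "finite J"
  shows "matrix_rank I J A \<le> card J"
proof -
  let ?E = "(\<lambda>j i. if i = j then 1 else 0 :: 'f) ` J"
  have "matrix_row J A ` I \<subseteq> fun_vs.span ?E"
    using assms by (auto simp: matrix_row_def intro!: in_span_unit_vectors)
  then have "matrix_rank I J A \<le> card ?E"
    unfolding matrix_rank_def using assms by (intro fun_vs.dim_le_card) auto
  also have "\<dots> \<le> card J"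
    using assms by (rule card_image_le)
  finally show ?thesis .
qed

text \<open>Discarding columns projects the row space linearly, and the image of a basis of the old
  row space spans the new one.\<close>

lemma matrix_rank_mono_columns:
  fixes A :: "'i \<Rightarrow> 'j \<Rightarrow> 'f::field"
  assumes "finite I" "J' \<subseteq> J"
  shows "matrix_rank I J' A \<le> matrix_rank I J A"
proof -
  let ?R = "matrix_row J A ` I" and ?r = "restrict_zero J' :: ('j \<Rightarrow> 'f) \<Rightarrow> 'j \<Rightarrow> 'f"
  interpret r: Vector_Spaces.linear fun_scale fun_scale ?r
    by (rule linear_restrict_zero)
  obtain B where B: "B \<subseteq> ?R" "?R \<subseteq> fun_vs.span B" "card B = fun_vs.dim ?R"
    by (rule fun_vs.basis_exists)
  then have fin: "finite B"
    using assms(1) by (auto intro: finite_subset)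
  have "matrix_row J' A ` I \<subseteq> fun_vs.span (?r ` B)"
    unfolding restrict_zero_matrix_row[OF assms(2), symmetric] r.span_image
    using B(2) by (rule image_mono)
  then have "matrix_rank I J' A \<le> card (?r ` B)"
    unfolding matrix_rank_def using fin by (intro fun_vs.dim_le_card) auto
  also have "\<dots> \<le> matrix_rank I J A"
    using B(3) card_image_le[OF fin, of ?r] by (simp add: matrix_rank_def)
  finally show ?thesis .
qed

text \<open>A dependency of column \<open>j\<close> on the columns in \<open>J'\<close> is a linear
  equation between coordinates that every row satisfies, hence every vector \<open>f\<close> of the
  row space. If \<open>f\<close> vanishes on \<open>J'\<close>, the equation forces
  \<open>f j = 0\<close>.\<close>

lemma vanishes_on_span_of_columns:
  fixes A :: "'i \<Rightarrow> 'j \<Rightarrow> 'f::field"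
  assumes f: "f \<in> fun_vs.span (matrix_row J A ` I)"
    and J': "J' \<subseteq> J" "\<And>j. j \<in> J' \<Longrightarrow> f j = 0"
    and j: "j \<in> J" "matrix_row I (\<lambda>j i. A i j) j \<in> fun_vs.span (matrix_row I (\<lambda>j i. A i j) ` J')"
  shows "f j = 0"
proof -
  let ?col = "matrix_row I (\<lambda>j i. A i j)"
  obtain T d where T: "finite T" "T \<subseteq> ?col ` J'" "?col j = (\<Sum>c\<in>T. fun_scale (d c) c)"
    using j(2) unfolding fun_vs.span_explicit by blast
  \<comment> \<open>Different indices may carry equal columns; one index per column lets the sum
    over columns become a sum over indices.\<close>
  obtain K where K: "K \<subseteq> J'" "inj_on ?col K" "T = ?col ` K"
    using T(2) unfolding subset_image_inj by auto
  have fun_sum: "(\<Sum>c\<in>X. h c) i = (\<Sum>c\<in>X. h c i)" for h :: "'j \<Rightarrow> 'i \<Rightarrow> 'f" and X i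
    by (induction X rule: infinite_finite_induct) auto
  have Aij: "A i j = (\<Sum>l\<in>K. d (?col l) * A i l)" if "i \<in> I" for i
  proof -
    have "?col j i = (\<Sum>l\<in>K. fun_scale (d (?col l)) (?col l)) i"
      using T(3) K by (simp add: sum.reindex)
    then show ?thesis
      using that by (simp add: fun_sum fun_scale_def matrix_row_def)
  qed
  \<comment> \<open>The solution space of the column dependency; it contains all rows and therefore
    their span.\<close>
  let ?W = "{g :: 'j \<Rightarrow> 'f. g j = (\<Sum>l\<in>K. d (?col l) * g l)}"
  have "fun_vs.subspace ?W"
    by (auto simp: fun_vs.subspace_def fun_scale_def algebra_simps sum.distrib sum_distrib_left)
  moreover have "matrix_row J A ` I \<subseteq> ?W"
  proof safe
    fix i assume i: "i \<in> I"
    have "(\<Sum>l\<in>K. d (?col l) * A i l) = (\<Sum>l\<in>K. d (?col l) * matrix_row J A i l)"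
      using K(1) J'(1) by (intro sum.cong) (auto simp: matrix_row_def)
    then show "matrix_row J A i j = (\<Sum>l\<in>K. d (?col l) * matrix_row J A i l)"
      using Aij[OF i] j(1) by (simp add: matrix_row_def)
  qed
  ultimately have "f \<in> ?W"
    by (intro subsetD[OF fun_vs.span_minimal f])
  then have "f j = (\<Sum>l\<in>K. d (?col l) * f l)"
    by simp
  also have "\<dots> = 0"
    using K(1) J'(2) by (intro sum.neutral) auto
  finally show ?thesis .
qed

text \<open>Let \<open>J'\<close> index a basis of the column space. A vector of the row space that
  vanishes on \<open>J'\<close> is zero, so projection to \<open>J'\<close> is injective there and
  keeps the rows distinct and independent.\<close>

lemma independent_rows_restrict:
  fixes A :: "'i \<Rightarrow> 'j \<Rightarrow> 'f::field"
  assumes "finite I" "inj_on (matrix_row J A) I" "fun_vs.independent (matrix_row J A ` I)"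
  obtains J' where "J' \<subseteq> J" "card J' \<le> card I" "matrix_rank I J' A = card I"
proof -
  let ?col = "matrix_row I (\<lambda>j i. A i j)" and ?R = "matrix_row J A ` I"
  obtain B where B: "B \<subseteq> ?col ` J" "?col ` J \<subseteq> fun_vs.span B" "card B = fun_vs.dim (?col ` J)"
    by (rule fun_vs.basis_exists)
  obtain J' where J': "J' \<subseteq> J" "inj_on ?col J'" "B = ?col ` J'"
    using B(1) unfolding subset_image_inj by auto
  \<comment> \<open>The columns are the rows of the transpose, which has only \<open>card I\<close>
    columns.\<close>
  have "card J' = matrix_rank J I (\<lambda>j i. A i j)"
    using J' B(3) by (simp add: card_image matrix_rank_def)
  then have card: "card J' \<le> card I"
    by (simp add: matrix_rank_le_card_columns[OF assms(1)])
  let ?r = "restrict_zero J' :: ('j \<Rightarrow> 'f) \<Rightarrow> 'j \<Rightarrow> 'f"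
  interpret r: Vector_Spaces.linear fun_scale fun_scale ?r
    by (rule linear_restrict_zero)
  \<comment> \<open>Vectors are functions on the whole type, so vanishing on \<open>J\<close> gives
    the zero vector only together with this.\<close>
  have outside: "f j = 0" if "f \<in> fun_vs.span ?R" "j \<notin> J" for f j
  proof -
    have "fun_vs.subspace {g :: 'j \<Rightarrow> 'f. g j = 0}"
      by (auto simp: fun_vs.subspace_def fun_scale_def)
    moreover have "?R \<subseteq> {g. g j = 0}"
      using that by (auto simp: matrix_row_def)
    ultimately have "f \<in> {g. g j = 0}"
      by (intro subsetD[OF fun_vs.span_minimal that(1)])
    then show ?thesis
      by simp
  qed
  have inj: "inj_on ?r (fun_vs.span ?R)"
    unfolding r.inj_on_iff_eq_0[OF fun_vs.subspace_span]
  proof (intro ballI impI)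
    fix f assume f: "f \<in> fun_vs.span ?R" "?r f = 0"
    have "f j = 0" if "j \<in> J'" for j
      using fun_cong[OF f(2), of j] that by (simp add: restrict_zero_def)
    then have "f j = 0" if "j \<in> J" for j
      using vanishes_on_span_of_columns[OF f(1) J'(1) _ that] B(2) J'(3) that by auto
    then have "f j = 0" for j
      using outside[OF f(1)] by (cases "j \<in> J") auto
    then show "f = 0"
      by (simp add: fun_eq_iff)
  qed
  have "fun_vs.independent (?r ` ?R)"
    using assms(3) inj by (rule r.independent_injective_image)
  then have "matrix_rank I J' A = card (?r ` ?R)"
    unfolding restrict_zero_matrix_row[OF J'(1)] matrix_rank_def
    by (rule fun_vs.dim_eq_card_independent)
  also have "\<dots> = card I"
    using card_image[OF inj_on_subset[OF inj fun_vs.span_superset]] card_image[OF assms(2)] by simp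
  finally show ?thesis
    by (rule that[OF J'(1) card])
qed

lemma matrix_rank_submatrix:
  fixes A :: "'i \<Rightarrow> 'j \<Rightarrow> 'f::field"
  assumes "finite I" "r \<le> matrix_rank I J A"
  obtains I' J' where "I' \<subseteq> I" "J' \<subseteq> J" "card I' = r" "card J' \<le> r" "matrix_rank I' J' A = r"
proof -
  let ?row = "matrix_row J A"
  obtain B where B: "B \<subseteq> ?row ` I" "fun_vs.independent B" "card B = matrix_rank I J A"
    unfolding matrix_rank_def by (rule fun_vs.basis_exists)
  obtain C where C: "C \<subseteq> B" "card C = r"
    using assms(2) unfolding B(3)[symmetric] by (rule obtain_subset_with_card_n)
  \<comment> \<open>Again one index per row, so that \<open>I'\<close> has exactly \<open>r\<close>
    elements.\<close>
  obtain I' where I': "I' \<subseteq> I" "inj_on ?row I'" "C = ?row ` I'"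
    using subset_trans[OF C(1) B(1)] unfolding subset_image_inj by auto
  have card: "card I' = r"
    using card_image[OF I'(2)] I'(3) C(2) by simp
  have ind: "fun_vs.independent (?row ` I')"
    using fun_vs.independent_mono[OF B(2) C(1)] I'(3) by simp
  have "finite I'"
    using I'(1) assms(1) by (rule finite_subset)
  from independent_rows_restrict[OF this I'(2) ind]
  obtain J' where "J' \<subseteq> J" "card J' \<le> card I'" "matrix_rank I' J' A = card I'" .
  then show ?thesis
    using that[of I' J'] I'(1) card by simp
qed

lemma cut_rank_le_max_cut_rank:
  assumes "finite (verts G)" "S \<subseteq> verts G"
  shows "cut_rank G S \<le> max_cut_rank G"
  unfolding max_cut_rank_def using assms by (intro Max_ge) auto

lemma max_cut_rank_attained:
  assumes "finite (verts G)"
  obtains S where "S \<subseteq> verts G" "cut_rank G S = max_cut_rank G"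
proof -
  have "max_cut_rank G \<in> {cut_rank G S | S. S \<subseteq> verts G}"
    unfolding max_cut_rank_def using assms by (intro Max_in) auto
  then show ?thesis
    using that by auto
qed

lemma adj_entry_del_vert:
  assumes "i \<noteq> v" "j \<noteq> v"
  shows "adj_entry (pre_digraph.del_vert G v) i j = adj_entry G i j"
proof -
  have "i \<rightarrow>\<^bsub>pre_digraph.del_vert G v\<^esub> j \<longleftrightarrow> i \<rightarrow>\<^bsub>G\<^esub> j"
    using assms by (auto simp: arcs_ends_def arc_to_ends_def pre_digraph.del_vert_def)
  then show ?thesis
    by (simp add: adj_entry_def)
qed

text \<open>With \<open>v\<close> outside \<open>S\<close>, deleting \<open>v\<close> keeps all rows
  of the cut matrix and only drops the column of \<open>v\<close>.\<close>

lemma cut_rank_del_vert: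
  assumes "v \<notin> S"
  shows "cut_rank (pre_digraph.del_vert G v) S = matrix_rank S (verts G - {v} - S) (adj_entry G)"
proof -
  have "matrix_row (verts G - {v} - S) (adj_entry (pre_digraph.del_vert G v)) ` S =
      matrix_row (verts G - {v} - S) (adj_entry G) ` S"
    using assms by (intro image_cong) (auto simp: matrix_row_def fun_eq_iff intro!: adj_entry_del_vert)
  then show ?thesis
    by (simp add: cut_rank_def matrix_rank_def pre_digraph.verts_del_vert)
qed

theorem theorem6p1:
  fixes G :: "('a, 'b) pre_digraph" and k :: nat
  assumes "Digraph.graph G"
    and "max_cut_rank G > k"
    and "\<And>v. v \<in> verts G \<Longrightarrow> max_cut_rank (pre_digraph.del_vert G v) \<le> k"
  shows "card (verts G) = 2 * k + 2"
proof -
  interpret Digraph.graph G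
    by fact
  let ?V = "verts G"
  have fin: "finite ?V"
    by (rule finite_verts)
  obtain S where S: "S \<subseteq> ?V" "k + 1 \<le> matrix_rank S (?V - S) (adj_entry G)"
  proof (rule max_cut_rank_attained[OF fin])
    fix S assume "S \<subseteq> ?V" "cut_rank G S = max_cut_rank G"
    then show thesis
      using that[of S] assms(2) by (simp add: cut_rank_def)
  qed
  have finS: "finite S"
    using S(1) fin by (rule finite_subset)
  obtain I J where IJ: "I \<subseteq> S" "J \<subseteq> ?V - S" "card I = k + 1" "card J \<le> k + 1"
    "matrix_rank I J (adj_entry G) = k + 1"
    by (rule matrix_rank_submatrix[OF finS S(2)])
  have finI: "finite I"
    using IJ(1) finS by (rule finite_subset)
  have "?V \<subseteq> I \<union> J"
  proof (rule ccontr)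
    assume "\<not> ?V \<subseteq> I \<union> J"
    then obtain v where v: "v \<in> ?V" "v \<notin> I" "v \<notin> J"
      by blast
    let ?H = "pre_digraph.del_vert G v"
    \<comment> \<open>The cut used in \<open>?H\<close> is \<open>I\<close> rather than
      \<open>S\<close>: \<open>J\<close> avoids both \<open>v\<close> and \<open>I\<close>, so the
      submatrix of rank \<open>k + 1\<close> lies inside this cut matrix, where the rest of
      \<open>S\<close> without \<open>v\<close> only adds columns.\<close>
    have "k + 1 \<le> matrix_rank I (?V - {v} - I) (adj_entry G)"
      using matrix_rank_mono_columns[OF finI, of J "?V - {v} - I" "adj_entry G"] IJ v by auto
    also have "\<dots> = cut_rank ?H I"
      using v(2) by (rule cut_rank_del_vert[symmetric])
    also have "\<dots> \<le> max_cut_rank ?H"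
      using fin S(1) IJ(1) v by (intro cut_rank_le_max_cut_rank) (auto simp: pre_digraph.verts_del_vert)
    also have "\<dots> \<le> k"
      using v(1) by (rule assms(3))
    finally show False
      by simp
  qed
  then have "?V = I \<union> J"
    using IJ S(1) by blast
  then have "card ?V \<le> 2 * k + 2"
    using card_Un_le[of I J] IJ by simp
  \<comment> \<open>For the lower bound, rank at least \<open>k + 1\<close> needs that many rows and
    that many columns.\<close>
  moreover have "k + 1 \<le> card S"
    using S(2) matrix_rank_le_card_rows[OF finS] by (rule order_trans)
  moreover have "k + 1 \<le> card (?V - S)"
    using S(2) matrix_rank_le_card_columns[OF finite_Diff[OF fin]] by (rule order_trans)
  moreover have "card ?V = card S + card (?V - S)"
    using S(1) fin finS by (simp add: card_Diff_subset card_mono)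
  ultimately show ?thesis
    by simp
qed

end
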